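(* Let $p,n\in\mathbb{N}$, $j=\begin{bmatrix} I_p&0\\0&-I_p\end{bmatrix}$, and let $H(x)\ge0$ ($x\ge0$) be a given (locally integrable) $2p\times2p$ Hamiltonian. Let $\mathcal{A}$ be an $n\times n$ matrix with $\det\mathcal{A}\neq0$, let $\mathcal{S}(0)>0$ be an $n\times n$ matrix and $\Lambda(0)$ an $n\times2p$ matrix such that $$\mathcal{A}\mathcal{S}(0)-\mathcal{S}(0)\mathcal{A}^*=\mathrm{i}\Lambda(0)j\Lambda(0)^*.$$ Let $\Lambda(x)$, $\mathcal{S}(x)$ and $w_{\mathcal{A}}(x,\lambda)$ be defined as in the context. Then the $2p\times n$ matrix function $$Y(x,t)=j\Lambda(x)^*(\mathcal{A}^* )^{-1}\mathcal{S}(x)^{-1}\mathrm{e}^{\mathrm{i}t\mathcal{A}}\mathcal{A}^{-1}$$ satisfies the dynamical canonical system $$\widetilde H(x)\frac{\partial}{\partial t}Y(x,t)=j\frac{\partial}{\partial x}Y(x,t)\qquad(x\ge0),$$ where the transformed Hamiltonian $\widetilde H$ is given by $$\widetilde H(x)=w_{\mathcal{A}}(x,0)^*H(x)w_{\mathcal{A}}(x,0).$$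
   Context: $^*$ is the conjugate transpose, $'$ is $d/dx$. $\Lambda(x)$ ($n\times2p$) and $\mathcal{S}(x)=\mathcal{S}(x)^*$ ($n\times n$) are the absolutely continuous solutions, with the initial values $\Lambda(0)$, $\mathcal{S}(0)$, of $$\Lambda'(x)=-\mathrm{i}\mathcal{A}\Lambda(x)jH(x),\qquad \mathcal{S}'(x)=\Lambda(x)jH(x)j\Lambda(x)^*.$$ Since $\mathcal{S}(0)>0$ and $H(x)\ge0$, one has $\mathcal{S}(x)>0$ for $x\ge0$. Further, $$w_{\mathcal{A}}(x,\lambda)=I_{2p}-\mathrm{i}j\Lambda(x)^*\mathcal{S}(x)^{-1}(\mathcal{A}-\lambda I_n)^{-1}\Lambda(x).$$ As $H$ is only assumed locally integrable, differential equations in $x$ are understood almost everywhere. *)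

theory Defs
  imports "HOL-Analysis.Analysis"
begin

text \<open>
  The space of \<open>2p\<close>-vectors is indexed by \<open>'p + 'p\<close>, with \<open>p = CARD('p)\<close>; the left
  (right) summand is the first (second) block.  Caution: the operations \<open>*\<close>, \<open>1\<close> and \<open>^\<close> of
  the library on type \<open>vec\<close> are componentwise and are not used on matrices here.
\<close>

definition adj :: "complex^'n^'m \<Rightarrow> complex^'m^'n" where
  "adj M = (\<chi> i k. cnj (M $ k $ i))"

definition cscale :: "complex \<Rightarrow> complex^'n^'m \<Rightarrow> complex^'n^'m" (infixr \<open>*\<^sub>C\<close> 75) where
  "c *\<^sub>C M = (\<chi> i k. c * M $ i $ k)"

definition hermitian :: "complex^'n^'n \<Rightarrow> bool" where
  "hermitian M \<longleftrightarrow> adj M = M"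

text \<open>The form \<open>v\<^sup>* M v\<close>; it is real if \<open>M\<close> is Hermitian.\<close>

definition quad_form :: "complex^'n^'n \<Rightarrow> complex^'n \<Rightarrow> complex" where
  "quad_form M v = (\<Sum>i\<in>UNIV. cnj (v $ i) * (M *v v) $ i)"

definition pos_semidef :: "complex^'n^'n \<Rightarrow> bool" where
  "pos_semidef M \<longleftrightarrow> hermitian M \<and> (\<forall>v. Re (quad_form M v) \<ge> 0)"

definition pos_def :: "complex^'n^'n \<Rightarrow> bool" where
  "pos_def M \<longleftrightarrow> hermitian M \<and> (\<forall>v. v \<noteq> 0 \<longrightarrow> Re (quad_form M v) > 0)"

definition mat_power :: "complex^'n^'n \<Rightarrow> nat \<Rightarrow> complex^'n^'n" where
  "mat_power M k = (((**) M) ^^ k) (mat 1)"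

definition mat_exp :: "complex^'n^'n \<Rightarrow> complex^'n^'n" where
  "mat_exp M = (\<Sum>k. (1 / fact k) *\<^sub>R mat_power M k)"

text \<open>The signature matrix \<open>diag(I\<^sub>p, -I\<^sub>p)\<close>.\<close>

definition jmat :: "complex^('p::finite + 'p)^('p + 'p)" where
  "jmat = (\<chi> i k. if i = k then (case i of Inl _ \<Rightarrow> 1 | Inr _ \<Rightarrow> -1) else 0)"

text \<open>The \<open>\<epsilon>\<close>-\<open>\<delta>\<close> definition of absolute continuity; \<open>D\<close> ranges over the finite families of
  nonoverlapping compact intervals in \<open>S\<close>, so \<open>Inf K\<close> and \<open>Sup K\<close> are the endpoints of \<open>K\<close>.\<close>

definition abs_continuous_on :: "real set \<Rightarrow> (real \<Rightarrow> 'a::real_normed_vector) \<Rightarrow> bool" where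
  "abs_continuous_on S f \<longleftrightarrow>
     (\<forall>\<epsilon>>0. \<exists>\<delta>>0. \<forall>D. D division_of \<Union>D \<and> \<Union>D \<subseteq> S \<and> (\<Sum>K\<in>D. measure lborel K) < \<delta> \<longrightarrow>
        (\<Sum>K\<in>D. norm (f (Sup K) - f (Inf K))) < \<epsilon>)"

definition loc_abs_continuous :: "(real \<Rightarrow> 'a::real_normed_vector) \<Rightarrow> bool" where
  "loc_abs_continuous f \<longleftrightarrow> (\<forall>b\<ge>0. abs_continuous_on {0..b} f)"

text \<open>\<open>f\<close> is an absolutely continuous solution on \<open>[0,\<infinity>)\<close> of \<open>f' = g\<close> almost everywhere.\<close>

definition ac_solution ::
  "(real \<Rightarrow> 'a::real_normed_vector) \<Rightarrow> (real \<Rightarrow> 'a) \<Rightarrow> bool" where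
  "ac_solution f g \<longleftrightarrow> loc_abs_continuous f \<and>
     (AE x in lebesgue. x \<ge> 0 \<longrightarrow> (f has_vector_derivative g x) (at x within {0..}))"

definition hamiltonian :: "(real \<Rightarrow> complex^('p::finite + 'p)^('p + 'p)) \<Rightarrow> bool" where
  "hamiltonian H \<longleftrightarrow> (\<forall>x\<ge>0. pos_semidef (H x)) \<and> (\<forall>b\<ge>0. H absolutely_integrable_on {0..b})"

definition transfer_fun ::
  "complex^'n^'n \<Rightarrow> (real \<Rightarrow> complex^('p::finite + 'p)^'n) \<Rightarrow> (real \<Rightarrow> complex^'n^'n) \<Rightarrow>
   real \<Rightarrow> complex \<Rightarrow> complex^('p + 'p)^('p + 'p)" where
  "transfer_fun A \<Lambda> S x z = mat 1 -
     \<i> *\<^sub>C (jmat ** adj (\<Lambda> x) ** matrix_inv (S x) ** matrix_inv (A - z *\<^sub>C mat 1) ** \<Lambda> x)"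

text \<open>\<open>H Y\<^sub>t = j Y\<^sub>x\<close> for almost every \<open>x \<ge> 0\<close> and all real \<open>t\<close>, where \<open>Y(\<cdot>,t)\<close> is
  locally absolutely continuous and the exceptional null set is independent of \<open>t\<close>.\<close>

definition dynamical_canonical_solution ::
  "(real \<Rightarrow> complex^('p::finite + 'p)^('p + 'p)) \<Rightarrow>
   (real \<Rightarrow> real \<Rightarrow> complex^'n^('p + 'p)) \<Rightarrow> bool" where
  "dynamical_canonical_solution H Y \<longleftrightarrow>
     (\<forall>t. loc_abs_continuous (\<lambda>x. Y x t)) \<and>
     (AE x in lebesgue. x \<ge> 0 \<longrightarrow> (\<forall>t. \<exists>Yt Yx.
        ((\<lambda>s. Y x s) has_vector_derivative Yt) (at t) \<and>
        ((\<lambda>y. Y y t) has_vector_derivative Yx) (at x within {0..}) \<and>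
        H x ** Yt = jmat ** Yx))"

end

theory Submission
  imports Defs
begin

text \<open>
  Write \<open>w = w\<^sub>A(x,0) = I - \<i> j \<Lambda>\<^sup>* S\<^sup>-\<^sup>1 A\<^sup>-\<^sup>1 \<Lambda>\<close>. The heart of the matter is the identity
  \<open>A S - S A\<^sup>* = \<i> \<Lambda> j \<Lambda>\<^sup>*\<close>. It holds at \<open>x = 0\<close> and, as both sides have the same derivative,
  for all \<open>x \<ge> 0\<close> (\<open>lyapunov_identity_preserved\<close>). It yields
  \<open>w j \<Lambda>\<^sup>* (A\<^sup>*)\<^sup>-\<^sup>1 S\<^sup>-\<^sup>1 = j \<Lambda>\<^sup>* S\<^sup>-\<^sup>1 A\<^sup>-\<^sup>1\<close> (\<open>transfer_fun_intertwining\<close>). As the exponential commutes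
  with \<open>A\<close>, one has \<open>Y\<^sub>t = \<i> j \<Lambda>\<^sup>* (A\<^sup>*)\<^sup>-\<^sup>1 S\<^sup>-\<^sup>1 e\<^sup>i\<^sup>t\<^sup>A\<close>, and therefore
  \<open>w\<^sup>* H w Y\<^sub>t = \<i> w\<^sup>* H j \<Lambda>\<^sup>* S\<^sup>-\<^sup>1 e\<^sup>i\<^sup>t\<^sup>A A\<^sup>-\<^sup>1\<close>. On the other hand, the differential equations
  and \<open>(S\<^sup>-\<^sup>1)' = - S\<^sup>-\<^sup>1 S' S\<^sup>-\<^sup>1\<close> give
  \<open>j Y\<^sub>x = \<i> (I + \<i> \<Lambda>\<^sup>* (A\<^sup>*)\<^sup>-\<^sup>1 S\<^sup>-\<^sup>1 \<Lambda> j) H j \<Lambda>\<^sup>* S\<^sup>-\<^sup>1 e\<^sup>i\<^sup>t\<^sup>A A\<^sup>-\<^sup>1\<close>, and the bracket is \<open>w\<^sup>*\<close>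
  because \<open>S\<close> is Hermitian (\<open>canonical_system_identity\<close>).

  The analysis behind this calculation is that an absolutely continuous real function whose
  derivative is nonnegative almost everywhere is nondecreasing
  (\<open>abs_continuous_on_nondecreasing\<close>), a consequence of Cousin's lemma. It has three uses: it
  propagates the identity above and the symmetry of \<open>S\<close>, both being equations between absolutely
  continuous functions; and, applied to
  \<open>v\<^sup>* S(x) v\<close>, whose derivative is \<open>u\<^sup>* H u \<ge> 0\<close> with \<open>u = j \<Lambda>\<^sup>* v\<close>, it gives
  \<open>S(x) \<ge> S(0) \<ge> c I\<close> with some \<open>c > 0\<close>. Hence \<open>S(x)\<close> is invertible with an inverse that is bounded
  uniformly in \<open>x\<close>. By the resolvent identity, \<open>S\<^sup>-\<^sup>1\<close> is then absolutely continuous, and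
  differentiable wherever \<open>S\<close> is.
\<close>

section \<open>Complex matrices and their adjoints\<close>

text \<open>
  The product rule, limits and norm bounds for products of rectangular matrices are instances
  of general facts on bounded bilinear maps.
\<close>

lemma bounded_bilinear_matrix_mult:
  "bounded_bilinear ((**) :: complex^'n^'m \<Rightarrow> complex^'k^'n \<Rightarrow> complex^'k^'m)"
  unfolding bilinear_conv_bounded_bilinear[symmetric] bilinear_def
  by (intro conjI allI linearI)
     (simp_all add: vec_eq_iff matrix_matrix_mult_def sum.distrib scaleR_sum_right algebra_simps)

lemmas matrix_mult_add_left = bounded_bilinear.add_left[OF bounded_bilinear_matrix_mult]
lemmas matrix_mult_add_right = bounded_bilinear.add_right[OF bounded_bilinear_matrix_mult]
lemmas matrix_mult_diff_left = bounded_bilinear.diff_left[OF bounded_bilinear_matrix_mult]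
lemmas matrix_mult_diff_right = bounded_bilinear.diff_right[OF bounded_bilinear_matrix_mult]
lemmas matrix_mult_minus_right = bounded_bilinear.minus_right[OF bounded_bilinear_matrix_mult]
lemmas matrix_mult_scaleR_right = bounded_bilinear.scaleR_right[OF bounded_bilinear_matrix_mult]
lemmas matrix_mult_scaleR_left = bounded_bilinear.scaleR_left[OF bounded_bilinear_matrix_mult]

lemma bounded_linear_adj: "bounded_linear (adj :: complex^'n^'m \<Rightarrow> complex^'m^'n)"
  unfolding linear_conv_bounded_linear[symmetric]
  by (rule linearI) (simp_all add: adj_def vec_eq_iff)

lemma bounded_linear_cscale: "bounded_linear (\<lambda>M :: complex^'n^'m. c *\<^sub>C M)"
  unfolding linear_conv_bounded_linear[symmetric]
  by (rule linearI) (simp_all add: cscale_def vec_eq_iff algebra_simps)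

lemma adj_adj [simp]: "adj (adj M) = M"
  by (simp add: adj_def vec_eq_iff)

lemma adj_mult: "adj (M ** N) = adj N ** adj M"
  by (simp add: adj_def vec_eq_iff matrix_matrix_mult_def mult.commute)

lemma adj_cscale: "adj (c *\<^sub>C M) = cnj c *\<^sub>C adj M"
  by (simp add: adj_def cscale_def vec_eq_iff)

lemma adj_mat_1 [simp]: "adj (mat 1) = mat 1"
  by (simp add: adj_def mat_def vec_eq_iff)

lemma adj_diff: "adj (M - N) = adj M - adj N"
  by (simp add: adj_def vec_eq_iff)

lemma adj_jmat [simp]: "adj jmat = jmat"
  by (auto simp: adj_def jmat_def vec_eq_iff split: sum.split)

lemma jmat_squared [simp]: "(jmat :: complex^('p::finite + 'p)^('p + 'p)) ** jmat = mat 1"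
proof -
  have "(\<Sum>l\<in>UNIV. (if i = l then case i of Inl a \<Rightarrow> 1 | Inr a \<Rightarrow> - 1 else 0) *
          (if l = k then case l of Inl a \<Rightarrow> 1 | Inr a \<Rightarrow> - 1 else 0)) =
        (if i = k then 1 else (0::complex))" for i k :: "'p + 'p"
  proof -
    have "(\<Sum>l\<in>UNIV. (if i = l then case i of Inl a \<Rightarrow> 1 | Inr a \<Rightarrow> - 1 else 0) *
          (if l = k then case l of Inl a \<Rightarrow> 1 | Inr a \<Rightarrow> - 1 else 0)) =
       (\<Sum>l\<in>UNIV. if l = i then (if i = k then 1 else (0::complex)) else 0)"
      by (rule sum.cong) (auto split: sum.split)
    then show ?thesis by simp
  qed
  then show ?thesis
    by (simp add: jmat_def matrix_matrix_mult_def mat_def vec_eq_iff)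
qed

lemma cscale_mult_left: "(c *\<^sub>C M) ** N = c *\<^sub>C (M ** N)"
  by (simp add: cscale_def matrix_matrix_mult_def vec_eq_iff sum_distrib_left mult.assoc)

lemma cscale_mult_right: "M ** (c *\<^sub>C N) = c *\<^sub>C (M ** N)"
  by (simp add: cscale_def matrix_matrix_mult_def vec_eq_iff sum_distrib_left mult.left_commute)

lemma cscale_cscale [simp]: "c *\<^sub>C d *\<^sub>C M = (c * d) *\<^sub>C M"
  by (simp add: cscale_def vec_eq_iff)

lemma cscale_add: "c *\<^sub>C (M + N) = c *\<^sub>C M + c *\<^sub>C N"
  and cscale_minus: "(- c) *\<^sub>C M = - (c *\<^sub>C M)"
  and cscale_nth: "(c *\<^sub>C M) $ i $ k = c * M $ i $ k"
  and cscale_1 [simp]: "1 *\<^sub>C M = M"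
  and cscale_0 [simp]: "0 *\<^sub>C M = 0"
  by (simp_all add: cscale_def vec_eq_iff algebra_simps)

lemma matrix_inv_unique:
  fixes M N :: "complex^'n^'n"
  assumes "N ** M = mat 1"
  shows "matrix_inv M = N"
proof -
  have MN: "M ** N = mat 1"
    using assms matrix_left_right_inverse by blast
  then have "\<exists>N. M ** N = mat 1 \<and> N ** M = mat 1"
    using assms by blast
  then have "M ** matrix_inv M = mat 1 \<and> matrix_inv M ** M = mat 1"
    unfolding matrix_inv_def by (rule someI_ex)
  then show ?thesis
    by (metis assms matrix_mul_assoc matrix_mul_lid matrix_mul_rid)
qed

lemma matrix_inv_mult:
  fixes M :: "complex^'n^'n"
  assumes "invertible M"
  shows "matrix_inv M ** M = mat 1" "M ** matrix_inv M = mat 1"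
proof -
  obtain N where "N ** M = mat 1" "M ** N = mat 1"
    using assms unfolding invertible_def by blast
  then show "matrix_inv M ** M = mat 1" "M ** matrix_inv M = mat 1"
    using matrix_inv_unique by force+
qed

lemma adj_matrix_inv:
  fixes M :: "complex^'n^'n"
  assumes "invertible M"
  shows "adj (matrix_inv M) = matrix_inv (adj M)"
proof (rule matrix_inv_unique[symmetric])
  show "adj (matrix_inv M) ** adj M = mat 1"
    by (simp add: adj_mult[symmetric] matrix_inv_mult[OF assms])
qed

lemma invertible_adj:
  fixes M :: "complex^'n^'n"
  assumes "invertible M"
  shows "invertible (adj M)"
  unfolding invertible_def
  by (rule exI[of _ "adj (matrix_inv M)"])
     (simp add: adj_mult[symmetric] matrix_inv_mult[OF assms])

section \<open>Closure properties of absolute continuity\<close>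

text \<open>
  Every closure property of absolute continuity below comes from a pointwise bound on
  increments: sums, products and inverses change by at most a constant times the
  changes of their ingredients.
\<close>

lemma abs_continuous_on_dominated:
  assumes "abs_continuous_on S f" "abs_continuous_on S g"
    and dom: "\<And>x y. x \<in> S \<Longrightarrow> y \<in> S \<Longrightarrow> norm (h x - h y) \<le> C * (norm (f x - f y) + norm (g x - g y))"
  shows "abs_continuous_on S h"
  unfolding abs_continuous_on_def
proof (intro allI impI)
  fix \<epsilon> :: real
  assume "0 < \<epsilon>"
  define c where "c = max C 1"
  have "c > 0" "C \<le> c" by (auto simp: c_def)
  define e where "e = \<epsilon> / (2 * c)"
  have "e > 0" using \<open>0 < \<epsilon>\<close> \<open>c > 0\<close> by (simp add: e_def)
  obtain d1 where d1: "d1 > 0" "\<And>D. D division_of \<Union>D \<and> \<Union>D \<subseteq> S \<and> (\<Sum>K\<in>D. measure lborel K) < d1 \<Longrightarrow>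
        (\<Sum>K\<in>D. norm (f (Sup K) - f (Inf K))) < e"
    using assms(1) \<open>e > 0\<close> unfolding abs_continuous_on_def by blast
  obtain d2 where d2: "d2 > 0" "\<And>D. D division_of \<Union>D \<and> \<Union>D \<subseteq> S \<and> (\<Sum>K\<in>D. measure lborel K) < d2 \<Longrightarrow>
        (\<Sum>K\<in>D. norm (g (Sup K) - g (Inf K))) < e"
    using assms(2) \<open>e > 0\<close> unfolding abs_continuous_on_def by blast
  show "\<exists>\<delta>>0. \<forall>D. D division_of \<Union>D \<and> \<Union>D \<subseteq> S \<and> (\<Sum>K\<in>D. measure lborel K) < \<delta> \<longrightarrow>
        (\<Sum>K\<in>D. norm (h (Sup K) - h (Inf K))) < \<epsilon>"
  proof (intro exI[of _ "min d1 d2"] conjI allI impI)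
    show "min d1 d2 > 0" using d1 d2 by simp
    fix D
    assume D: "D division_of \<Union>D \<and> \<Union>D \<subseteq> S \<and> (\<Sum>K\<in>D. measure lborel K) < min d1 d2"
    have ends: "Inf K \<in> S \<and> Sup K \<in> S" if "K \<in> D" for K
    proof -
      have "K \<noteq> {}" "\<exists>a b. K = cbox a b"
        using D that division_ofD by blast+
      then obtain a b where "K = {a..b}" "a \<le> b" by auto
      then have "Inf K \<in> K" "Sup K \<in> K" by auto
      then show ?thesis using D that by blast
    qed
    have "(\<Sum>K\<in>D. norm (h (Sup K) - h (Inf K))) \<le>
        (\<Sum>K\<in>D. c * (norm (f (Sup K) - f (Inf K)) + norm (g (Sup K) - g (Inf K))))"
    proof (rule sum_mono)
      fix K assume "K \<in> D"
      then have "norm (h (Sup K) - h (Inf K)) \<le>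
          C * (norm (f (Sup K) - f (Inf K)) + norm (g (Sup K) - g (Inf K)))"
        using dom ends by blast
      also have "\<dots> \<le> c * (norm (f (Sup K) - f (Inf K)) + norm (g (Sup K) - g (Inf K)))"
        using \<open>C \<le> c\<close> by (intro mult_right_mono) auto
      finally show "norm (h (Sup K) - h (Inf K)) \<le> \<dots>" .
    qed
    also have "\<dots> = c * ((\<Sum>K\<in>D. norm (f (Sup K) - f (Inf K))) + (\<Sum>K\<in>D. norm (g (Sup K) - g (Inf K))))"
      by (simp add: sum_distrib_left[symmetric] sum.distrib)
    also have "\<dots> < c * (e + e)"
      using d1(2)[of D] d2(2)[of D] D \<open>c > 0\<close> by (intro mult_strict_left_mono add_strict_mono) auto
    also have "\<dots> = \<epsilon>" using \<open>c > 0\<close> by (simp add: e_def)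
    finally show "(\<Sum>K\<in>D. norm (h (Sup K) - h (Inf K))) < \<epsilon>" .
  qed
qed

lemma abs_continuous_on_imp_continuous_on:
  fixes f :: "real \<Rightarrow> 'a::real_normed_vector"
  assumes "abs_continuous_on {a..b} f"
  shows "continuous_on {a..b} f"
  unfolding continuous_on_iff
proof (intro ballI allI impI)
  fix x and \<epsilon> :: real
  assume x: "x \<in> {a..b}" and "0 < \<epsilon>"
  obtain d where d: "d > 0" "\<And>D. D division_of \<Union>D \<and> \<Union>D \<subseteq> {a..b} \<and> (\<Sum>K\<in>D. measure lborel K) < d \<Longrightarrow>
        (\<Sum>K\<in>D. norm (f (Sup K) - f (Inf K))) < \<epsilon>"
    using assms \<open>\<epsilon> > 0\<close> unfolding abs_continuous_on_def by blast
  have *: "norm (f v - f u) < \<epsilon>" if "u \<in> {a..b}" "v \<in> {a..b}" "u \<le> v" "v - u < d" for u v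
  proof -
    have "{cbox u v} division_of \<Union>{cbox u v}"
      using that division_of_self[of u v] by simp
    then show ?thesis using d(2)[of "{cbox u v}"] that by auto
  qed
  show "\<exists>d>0. \<forall>x'\<in>{a..b}. dist x' x < d \<longrightarrow> dist (f x') (f x) < \<epsilon>"
  proof (intro exI[of _ d] conjI ballI impI)
    fix y assume y: "y \<in> {a..b}" "dist y x < d"
    show "dist (f y) (f x) < \<epsilon>"
    proof (cases "x \<le> y")
      case True
      then show ?thesis using *[of x y] x y by (auto simp: dist_norm)
    next
      case False
      then show ?thesis using *[of y x] x y by (auto simp: dist_norm norm_minus_commute)
    qed
  qed (rule d(1))
qed

lemma abs_continuous_on_bounded:
  fixes f :: "real \<Rightarrow> 'a::real_normed_vector"
  assumes "abs_continuous_on {a..b} f"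
  obtains B where "B \<ge> 0" "\<And>x. x \<in> {a..b} \<Longrightarrow> norm (f x) \<le> B"
proof -
  have "compact (f ` {a..b})"
    using abs_continuous_on_imp_continuous_on[OF assms] by (intro compact_continuous_image) auto
  then have "bounded (f ` {a..b})" by (rule compact_imp_bounded)
  then obtain B where "B > 0" "\<And>x. x \<in> {a..b} \<Longrightarrow> norm (f x) \<le> B"
    unfolding bounded_pos by auto
  then show ?thesis using that[of B] by auto
qed

lemma (in bounded_linear) loc_abs_continuous:
  assumes "loc_abs_continuous g"
  shows "loc_abs_continuous (\<lambda>x. f (g x))"
proof -
  obtain K where K: "\<And>x. norm (f x) \<le> norm x * K" and "0 \<le> K"
    using nonneg_bounded by blast
  have "abs_continuous_on {0..b} (\<lambda>x. f (g x))" if "b \<ge> 0" for b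
  proof (rule abs_continuous_on_dominated[where C = K])
    show "abs_continuous_on {0..b} g" "abs_continuous_on {0..b} g"
      using assms that by (auto simp: loc_abs_continuous_def)
    fix x y
    have "norm (f (g x) - f (g y)) \<le> norm (g x - g y) * K"
      using K by (simp add: diff[symmetric])
    also have "\<dots> \<le> K * (norm (g x - g y) + norm (g x - g y))"
      using \<open>0 \<le> K\<close> by (simp add: algebra_simps)
    finally show "norm (f (g x) - f (g y)) \<le> K * (norm (g x - g y) + norm (g x - g y))" .
  qed
  then show ?thesis by (simp add: loc_abs_continuous_def)
qed

lemma loc_abs_continuous_diff:
  assumes "loc_abs_continuous f" "loc_abs_continuous g"
  shows "loc_abs_continuous (\<lambda>x. f x - g x)"
proof -
  have "abs_continuous_on {0..b} (\<lambda>x. f x - g x)" if "b \<ge> 0" for b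
  proof (rule abs_continuous_on_dominated[where C = 1])
    show "abs_continuous_on {0..b} f" "abs_continuous_on {0..b} g"
      using assms that by (auto simp: loc_abs_continuous_def)
    show "norm (f x - g x - (f y - g y)) \<le> 1 * (norm (f x - f y) + norm (g x - g y))" for x y
      using norm_triangle_ineq4[of "f x - f y" "g x - g y"] by (simp add: algebra_simps)
  qed
  then show ?thesis by (simp add: loc_abs_continuous_def)
qed

text \<open>
  Absolute continuity of a product rests on both factors being bounded on compact intervals:
  \<open>f(x)g(x) - f(y)g(y) = f(x)(g(x) - g(y)) + (f(x) - f(y))g(y)\<close>.
\<close>

lemma loc_abs_continuous_bilinear:
  assumes "bounded_bilinear h" "loc_abs_continuous f" "loc_abs_continuous g"
  shows "loc_abs_continuous (\<lambda>x. h (f x) (g x))"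
proof -
  interpret bounded_bilinear h by fact
  obtain K where K: "\<And>a b. norm (h a b) \<le> norm a * norm b * K" and "0 \<le> K"
    using nonneg_bounded by blast
  have "abs_continuous_on {0..b} (\<lambda>x. h (f x) (g x))" if "b \<ge> 0" for b
  proof -
    have ac: "abs_continuous_on {0..b} f" "abs_continuous_on {0..b} g"
      using assms(2,3) that by (auto simp: loc_abs_continuous_def)
    obtain F where F: "F \<ge> 0" "\<And>x. x \<in> {0..b} \<Longrightarrow> norm (f x) \<le> F"
      using abs_continuous_on_bounded[OF ac(1)] by blast
    obtain G where G: "G \<ge> 0" "\<And>x. x \<in> {0..b} \<Longrightarrow> norm (g x) \<le> G"
      using abs_continuous_on_bounded[OF ac(2)] by blast
    show ?thesis
    proof (rule abs_continuous_on_dominated[OF ac, where C = "(F + G) * K"])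
      fix x y assume xy: "x \<in> {0..b}" "y \<in> {0..b}"
      have "h (f x) (g x) - h (f y) (g y) = h (f x) (g x - g y) + h (f x - f y) (g y)"
        by (simp add: diff_left diff_right)
      then have "norm (h (f x) (g x) - h (f y) (g y)) \<le> norm (h (f x) (g x - g y)) + norm (h (f x - f y) (g y))"
        by (simp add: norm_triangle_ineq)
      also have "\<dots> \<le> norm (f x) * norm (g x - g y) * K + norm (f x - f y) * norm (g y) * K"
        by (intro add_mono K)
      also have "\<dots> \<le> (F + G) * norm (g x - g y) * K + norm (f x - f y) * (F + G) * K"
        using F(2)[OF xy(1)] G(2)[OF xy(2)] F(1) G(1) \<open>0 \<le> K\<close>
        by (intro add_mono mult_right_mono mult_left_mono) auto
      also have "\<dots> = (F + G) * K * (norm (f x - f y) + norm (g x - g y))"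
        by (simp add: algebra_simps)
      finally show "norm (h (f x) (g x) - h (f y) (g y)) \<le> \<dots>" .
    qed
  qed
  then show ?thesis by (simp add: loc_abs_continuous_def)
qed


section \<open>Absolutely continuous functions and the sign of the derivative\<close>

text \<open>
  Cousin's lemma divides \<open>{a..b}\<close> into tagged intervals that are small in a sense that depends
  on the tag. At a tag outside the null set \<open>N\<close>, the derivative is nonnegative, so that the
  function drops over the interval by at most \<open>\<epsilon>\<close> times the length. The intervals tagged in \<open>N\<close> lie in an open set of measure less than
  \<open>\<delta>\<close>, so absolute continuity bounds the total change over them by \<open>\<epsilon>\<close>.
\<close>

lemma abs_continuous_on_nondecreasing:
  fixes f :: "real \<Rightarrow> real"
  assumes "a \<le> b" and ac: "abs_continuous_on {a..b} f"
    and N: "N \<in> null_sets lebesgue"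
    and der: "\<And>x. x \<in> {a..b} - N \<Longrightarrow> \<exists>d\<ge>0. (f has_vector_derivative d) (at x within {a..b})"
  shows "f a \<le> f b"
proof -
  have main: "f a \<le> f b + \<epsilon> * (1 + (b - a))" if "\<epsilon> > 0" for \<epsilon>
  proof -
    obtain \<delta> where \<delta>: "\<delta> > 0" "\<And>D. D division_of \<Union>D \<and> \<Union>D \<subseteq> {a..b} \<and> (\<Sum>K\<in>D. measure lborel K) < \<delta> \<Longrightarrow>
        (\<Sum>K\<in>D. norm (f (Sup K) - f (Inf K))) < \<epsilon>"
      using ac \<open>\<epsilon> > 0\<close> unfolding abs_continuous_on_def by blast
    obtain U where U: "open U" "N \<subseteq> U" "(U - N) \<in> lmeasurable" "emeasure lebesgue (U - N) < ennreal \<delta>"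
      using sets_lebesgue_outer_open[of N \<delta>] N \<open>\<delta> > 0\<close> by auto
    have emU: "emeasure lebesgue U < ennreal \<delta>"
      using U(4) emeasure_Diff_null_set[OF N, of U] U(1) by simp
    then have mU: "U \<in> lmeasurable"
      using U(1) by (intro fmeasurableI) (auto intro: less_trans)
    have measU: "measure lebesgue U < \<delta>"
      using emU \<open>\<delta> > 0\<close> mU by (simp add: emeasure_eq_measure2 ennreal_less_iff)
    have "\<exists>r>0. x \<in> {a..b} - N \<longrightarrow> (\<forall>u v. u \<in> {a..b} \<and> v \<in> {a..b} \<and> u \<le> x \<and> x \<le> v \<and>
        {u..v} \<subseteq> ball x r \<longrightarrow> f u - f v \<le> \<epsilon> * (v - u))" for x
    proof (cases "x \<in> {a..b} - N")
      case True
      then obtain d where d: "d \<ge> 0" "(f has_vector_derivative d) (at x within {a..b})"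
        using der by blast
      then obtain r where r: "r > 0" and
        lin: "\<And>y. y \<in> {a..b} \<Longrightarrow> norm (y - x) < r \<Longrightarrow> norm (f y - f x - (y - x) *\<^sub>R d) \<le> \<epsilon> * norm (y - x)"
        using \<open>\<epsilon> > 0\<close> unfolding has_vector_derivative_def has_derivative_within_alt by blast
      have "f u - f v \<le> \<epsilon> * (v - u)"
        if uv: "u \<in> {a..b}" "v \<in> {a..b}" "u \<le> x" "x \<le> v" "{u..v} \<subseteq> ball x r" for u v
      proof -
        have "u \<in> {u..v}" "v \<in> {u..v}" using uv by auto
        then have "u \<in> ball x r" "v \<in> ball x r" using uv(5) by blast+
        then have "\<bar>f u - f x - (u - x) * d\<bar> \<le> \<epsilon> * (x - u)" "\<bar>f v - f x - (v - x) * d\<bar> \<le> \<epsilon> * (v - x)"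
          using lin[of u] lin[of v] uv by (auto simp: dist_real_def)
        moreover have "(u - x) * d \<le> 0" "(v - x) * d \<ge> 0"
          using uv d by (auto simp: mult_nonpos_nonneg)
        ultimately have "f u - f x \<le> \<epsilon> * (x - u)" "f x - f v \<le> \<epsilon> * (v - x)"
          by linarith+
        then have "f u - f v \<le> \<epsilon> * (x - u) + \<epsilon> * (v - x)" by linarith
        then show ?thesis by (simp add: algebra_simps)
      qed
      then show ?thesis using r by blast
    qed (auto intro: exI[of _ 1])
    then obtain r where r: "\<And>x. r x > 0" and
      good: "\<And>x u v. x \<in> {a..b} - N \<Longrightarrow> u \<in> {a..b} \<Longrightarrow> v \<in> {a..b} \<Longrightarrow> u \<le> x \<Longrightarrow> x \<le> v \<Longrightarrow>
        {u..v} \<subseteq> ball x (r x) \<Longrightarrow> f u - f v \<le> \<epsilon> * (v - u)"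
      by metis
    \<comment> \<open>Fineness confines the intervals tagged in \<open>N\<close> to \<open>U\<close> and the others to the range of \<open>good\<close>.\<close>
    define \<gamma> where "\<gamma> x = (if x \<in> N then U else ball x (r x))" for x
    have "gauge \<gamma>"
      using U(1,2) r by (auto simp: gauge_def \<gamma>_def)
    then obtain p where p: "p tagged_division_of {a..b}" and fine: "\<gamma> fine p"
      by (rule fine_division_exists_real)
    have fin: "finite p" using p by blast
    define q where "q = {(x, K) \<in> p. x \<in> N}"
    have "q \<subseteq> p" by (auto simp: q_def)
    have elem: "\<exists>u v. K = {u..v} \<and> u \<le> v \<and> u \<le> x \<and> x \<le> v \<and> a \<le> u \<and> v \<le> b" if "(x, K) \<in> p" for x K
    proof -
      have "x \<in> K" "K \<subseteq> {a..b}" "\<exists>u v. K = cbox u v"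
        using tagged_division_ofD[OF p] that by blast+
      then show ?thesis by auto
    qed
    have q: "q tagged_division_of \<Union>(snd ` q)"
      using p \<open>q \<subseteq> p\<close> tagged_partial_division_of_Union_self tagged_partial_division_subset
        tagged_division_of_def by metis
    have qdiv: "snd ` q division_of \<Union>(snd ` q)"
      by (rule division_of_tagged_division[OF q])
    have qU: "\<Union>(snd ` q) \<subseteq> U"
    proof (rule Union_least)
      fix K assume "K \<in> snd ` q"
      then obtain x where "(x, K) \<in> p" "x \<in> N" by (auto simp: q_def)
      then show "K \<subseteq> U" using fineD[OF fine] by (fastforce simp: \<gamma>_def)
    qed
    have qab: "\<Union>(snd ` q) \<subseteq> {a..b}"
      using tagged_division_ofD(3)[OF p] by (force simp: q_def)
    have "measure lborel K = measure lebesgue K" if "K \<in> snd ` q" for K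
      using division_ofD(4)[OF qdiv that] by auto
    then have "(\<Sum>K\<in>snd ` q. measure lborel K) = measure lebesgue (\<Union>(snd ` q))"
      using content_division[OF qdiv] by simp
    also have "\<dots> \<le> measure lebesgue U"
      using qU mU lmeasurable_division[OF qdiv] by (intro measure_mono_fmeasurable) auto
    finally have "(\<Sum>K\<in>snd ` q. norm (f (Sup K) - f (Inf K))) < \<epsilon>"
      using \<delta>(2)[of "snd ` q"] qdiv qab measU by auto
    also have "(\<Sum>K\<in>snd ` q. norm (f (Sup K) - f (Inf K))) =
        (\<Sum>(x, K)\<in>q. norm (f (Sup K) - f (Inf K)))"
    proof -
      \<comment> \<open>A degenerate interval may carry several tags, so passing from tagged intervals to intervals
        needs a summand that vanishes on all of them, the empty one included.\<close>
      define d where "d K = (if K = {} then 0 else norm (f (Sup K) - f (Inf K)))" for K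
      have ne: "d K = norm (f (Sup K) - f (Inf K))" if "(x, K) \<in> q" for x K
        using tagged_division_ofD(2)[OF q that] by (auto simp: d_def)
      have "(\<Sum>K\<in>snd ` q. norm (f (Sup K) - f (Inf K))) = (\<Sum>K\<in>snd ` q. d K)"
        using ne by (intro sum.cong) auto
      also have "\<dots> = (\<Sum>(x, K)\<in>q. d K)"
      proof (rule sum.over_tagged_division_lemma[OF q, symmetric])
        fix u v :: real
        assume "box u v = {}"
        then have "v \<le> u" by simp
        then show "d (cbox u v) = 0"
          by (cases "u = v") (auto simp: d_def)
      qed
      also have "\<dots> = (\<Sum>(x, K)\<in>q. norm (f (Sup K) - f (Inf K)))"
        using ne by (intro sum.cong) auto
      finally show ?thesis .
    qed
    finally have bad: "(\<Sum>(x, K)\<in>q. norm (f (Sup K) - f (Inf K))) < \<epsilon>" .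
    have "f a - f b = (\<Sum>(x, K)\<in>p. f (Inf K) - f (Sup K))"
      using additive_tagged_division_1[OF \<open>a \<le> b\<close> p, of "\<lambda>x. - f x"] by simp
    also have "\<dots> \<le> (\<Sum>(x, K)\<in>p. \<epsilon> * measure lborel K + (if x \<in> N then norm (f (Sup K) - f (Inf K)) else 0))"
    proof (rule sum_mono, clarify)
      fix x K
      assume xK: "(x, K) \<in> p"
      then obtain u v where uv: "K = {u..v}" "u \<le> v" "u \<le> x" "x \<le> v" "a \<le> u" "v \<le> b"
        using elem by blast
      show "f (Inf K) - f (Sup K) \<le> \<epsilon> * measure lborel K + (if x \<in> N then norm (f (Sup K) - f (Inf K)) else 0)"
      proof (cases "x \<in> N")
        case True
        then show ?thesis using uv \<open>\<epsilon> > 0\<close> by (simp add: add_increasing)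
      next
        case False
        then have "K \<subseteq> ball x (r x)"
          using fineD[OF fine xK] by (simp add: \<gamma>_def)
        then show ?thesis using good[of x u v] False uv by auto
      qed
    qed
    also have "\<dots> = \<epsilon> * (\<Sum>(x, K)\<in>p. measure lborel K) +
        (\<Sum>(x, K)\<in>p. if x \<in> N then norm (f (Sup K) - f (Inf K)) else 0)"
      by (simp add: case_prod_unfold sum.distrib sum_distrib_left)
    also have "(\<Sum>(x, K)\<in>p. measure lborel K) = b - a"
      using additive_content_tagged_division[of p a b] p \<open>a \<le> b\<close> by simp
    also have "(\<Sum>(x, K)\<in>p. if x \<in> N then norm (f (Sup K) - f (Inf K)) else 0) =
        (\<Sum>(x, K)\<in>q. norm (f (Sup K) - f (Inf K)))"
      using fin \<open>q \<subseteq> p\<close> by (intro sum.mono_neutral_cong_right) (auto simp: q_def split: if_splits)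
    finally show ?thesis using bad by (simp add: algebra_simps)
  qed
  show ?thesis
  proof (rule field_le_epsilon)
    fix e :: real
    assume "e > 0"
    then show "f a \<le> f b + e"
      using main[of "e / (1 + (b - a))"] \<open>a \<le> b\<close> by simp
  qed
qed

lemma loc_abs_continuous_nondecreasing:
  fixes f :: "real \<Rightarrow> real"
  assumes ac: "loc_abs_continuous f"
    and der: "AE x in lebesgue. x \<ge> 0 \<longrightarrow> (\<exists>d\<ge>0. (f has_vector_derivative d) (at x within {0..}))"
    and "x \<ge> 0"
  shows "f 0 \<le> f x"
proof -
  obtain N where N: "N \<in> null_sets lebesgue"
    "\<And>x. x \<notin> N \<Longrightarrow> x \<ge> 0 \<longrightarrow> (\<exists>d\<ge>0. (f has_vector_derivative d) (at x within {0..}))"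
    using der by (rule AE_E3) auto
  show ?thesis
  proof (rule abs_continuous_on_nondecreasing[OF \<open>x \<ge> 0\<close> _ N(1)])
    show "abs_continuous_on {0..x} f"
      using ac \<open>x \<ge> 0\<close> by (simp add: loc_abs_continuous_def)
    fix y assume "y \<in> {0..x} - N"
    then obtain d where "d \<ge> 0" "(f has_vector_derivative d) (at y within {0..})"
      using N(2) by auto
    then show "\<exists>d\<ge>0. (f has_vector_derivative d) (at y within {0..x})"
      using has_vector_derivative_within_subset[of f d y "{0..}" "{0..x}"] by auto
  qed
qed

text \<open>
  The uniqueness principle by which identities between the solutions propagate from \<open>x = 0\<close>:
  each coordinate and its negative are nondecreasing.
\<close>

lemma loc_abs_continuous_eq_initial:
  fixes f :: "real \<Rightarrow> 'a::euclidean_space"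
  assumes ac: "loc_abs_continuous f"
    and der: "AE x in lebesgue. x \<ge> 0 \<longrightarrow> (f has_vector_derivative 0) (at x within {0..})"
    and "x \<ge> 0"
  shows "f x = f 0"
proof (rule euclidean_eqI)
  have le: "f 0 \<bullet> v \<le> f x \<bullet> v" for v
  proof (rule loc_abs_continuous_nondecreasing[OF _ _ \<open>x \<ge> 0\<close>])
    show "loc_abs_continuous (\<lambda>x. f x \<bullet> v)"
      by (rule bounded_linear.loc_abs_continuous[OF bounded_linear_inner_left ac])
    show "AE x in lebesgue. x \<ge> 0 \<longrightarrow>
        (\<exists>d\<ge>0. ((\<lambda>x. f x \<bullet> v) has_vector_derivative d) (at x within {0..}))"
      using der by eventually_elim
        (auto intro!: exI[of _ 0] dest: bounded_linear.has_vector_derivative[OF bounded_linear_inner_left[of v]])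
  qed
  show "f x \<bullet> i = f 0 \<bullet> i" for i
    using le[of i] le[of "- i"] by (simp add: inner_minus_right)
qed

section \<open>Coercive matrices\<close>

lemma Re_quad_form: "Re (quad_form M v) = v \<bullet> (M *v v)"
  by (simp add: quad_form_def inner_vec_def inner_complex_def)

lemma inner_matrix_vector_adj:
  fixes M :: "complex^'n^'m"
  shows "v \<bullet> (M *v w) = (adj M *v v) \<bullet> w"
proof -
  have "v \<bullet> (M *v w) = Re (\<Sum>i\<in>UNIV. \<Sum>k\<in>UNIV. cnj (v $ i) * (M $ i $ k * w $ k))"
    by (simp add: inner_vec_def inner_complex_def matrix_vector_mult_def sum_distrib_left algebra_simps sum.distrib sum_subtractf)
  also have "(\<Sum>i\<in>UNIV. \<Sum>k\<in>UNIV. cnj (v $ i) * (M $ i $ k * w $ k)) =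
      (\<Sum>k\<in>UNIV. \<Sum>i\<in>UNIV. cnj (v $ i) * (M $ i $ k * w $ k))"
    by (rule sum.swap)
  also have "Re \<dots> = (adj M *v v) \<bullet> w"
    by (simp add: inner_vec_def inner_complex_def matrix_vector_mult_def adj_def sum_distrib_left
      sum_distrib_right algebra_simps sum.distrib sum_subtractf)
  finally show ?thesis .
qed

lemma bounded_linear_matrix_vector_left:
  fixes v :: "complex^'n"
  shows "bounded_linear (\<lambda>M :: complex^'n^'m. M *v v)"
  unfolding linear_conv_bounded_linear[symmetric]
  by (rule linearI) (simp_all add: matrix_vector_mult_def vec_eq_iff algebra_simps sum.distrib scaleR_sum_right)

text \<open>
  The constant is the minimum of the form on the compact unit sphere.
\<close>

lemma pos_def_coercive:
  fixes M :: "complex^'n^'n"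
  assumes "pos_def M"
  obtains c where "c > 0" "\<And>v. c * (norm v)\<^sup>2 \<le> v \<bullet> (M *v v)"
proof -
  have lin: "linear (\<lambda>v. M *v v)"
    by (rule linearI) (simp_all add: matrix_vector_mult_def vec_eq_iff algebra_simps sum.distrib scaleR_sum_right)
  have "continuous_on (sphere (0 :: complex^'n) 1) (\<lambda>v. v \<bullet> (M *v v))"
    by (intro continuous_intros linear_continuous_on linear_conv_bounded_linear[THEN iffD1] lin)
  moreover have "sphere (0 :: complex^'n) 1 \<noteq> {}"
    by simp
  ultimately obtain u where u: "u \<in> sphere (0 :: complex^'n) 1"
    "\<And>v. v \<in> sphere 0 1 \<Longrightarrow> u \<bullet> (M *v u) \<le> v \<bullet> (M *v v)"
    using continuous_attains_inf[OF compact_sphere] by blast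
  show ?thesis
  proof
    have "u \<noteq> 0" using u(1) by auto
    then show "u \<bullet> (M *v u) > 0"
      using assms by (simp add: pos_def_def Re_quad_form)
    fix v :: "complex^'n"
    show "(u \<bullet> (M *v u)) * (norm v)\<^sup>2 \<le> v \<bullet> (M *v v)"
    proof (cases "v = 0")
      case False
      define w where "w = (1 / norm v) *\<^sub>R v"
      have v: "v = norm v *\<^sub>R w" using False by (simp add: w_def)
      have "norm w = 1" using False by (simp add: w_def)
      then have "u \<bullet> (M *v u) \<le> w \<bullet> (M *v w)" using u(2) by simp
      moreover have "v \<bullet> (M *v v) = (norm v)\<^sup>2 * (w \<bullet> (M *v w))"
        by (subst (1 2) v) (simp add: linear_scale[OF lin] power2_eq_square)
      ultimately show ?thesis
        by (simp add: mult.commute mult_right_mono)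
    qed (simp add: matrix_vector_mult_def)
  qed
qed

lemma coercive_invertible:
  fixes M :: "complex^'n^'n"
  assumes "c > 0" "\<And>v. c * (norm v)\<^sup>2 \<le> v \<bullet> (M *v v)"
  shows "invertible M"
proof -
  have "v = 0" if "M *v v = 0" for v
  proof -
    have "c * (norm v)\<^sup>2 \<le> 0" using assms(2)[of v] that by simp
    then show ?thesis using \<open>c > 0\<close> by (simp add: mult_le_0_iff)
  qed
  then show ?thesis
    by (simp add: invertible_left_inverse matrix_left_invertible_ker)
qed

lemma norm_matrix_le_sum:
  fixes M :: "complex^'n^'m"
  shows "norm M \<le> (\<Sum>i\<in>UNIV. \<Sum>k\<in>UNIV. norm (M $ i $ k))"
proof -
  have "norm M \<le> (\<Sum>i\<in>UNIV. norm (M $ i))"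
    unfolding norm_vec_def[of M] by (rule L2_set_le_sum) simp
  also have "\<dots> \<le> (\<Sum>i\<in>UNIV. \<Sum>k\<in>UNIV. norm (M $ i $ k))"
    by (intro sum_mono) (simp add: norm_vec_def L2_set_le_sum)
  finally show ?thesis .
qed

text \<open>
  If \<open>M w = e\<close> for a unit vector \<open>e\<close>, then \<open>c |w|\<^sup>2 \<le> w \<bullet> e \<le> |w|\<close>, so the columns of the inverse
  have length at most \<open>1 / c\<close>. The bound depends on \<open>M\<close> only through \<open>c\<close>, which makes it uniform
  over a family of matrices that dominate a fixed positive definite one.
\<close>

lemma coercive_norm_matrix_inv:
  fixes M :: "complex^'n^'n"
  assumes c: "c > 0" "\<And>v. c * (norm v)\<^sup>2 \<le> v \<bullet> (M *v v)"
  shows "norm (matrix_inv M) \<le> real CARD('n) * real CARD('n) / c"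
proof -
  have inv: "invertible M" using c by (rule coercive_invertible)
  have entry: "norm (matrix_inv M $ i $ k) \<le> 1 / c" for i k
  proof -
    \<comment> \<open>\<open>w\<close> is the column \<open>k\<close> of the inverse.\<close>
    define e :: "complex^'n" where "e = axis k 1"
    define w where "w = matrix_inv M *v e"
    have Mw: "M *v w = e"
      by (simp add: w_def matrix_vector_mul_assoc matrix_inv_mult[OF inv])
    have "c * (norm w)\<^sup>2 \<le> w \<bullet> e" using c(2)[of w] Mw by simp
    also have "\<dots> \<le> norm w * norm e" by (rule norm_cauchy_schwarz)
    also have "norm e = 1" by (simp add: e_def norm_vec_def L2_set_def axis_def if_distrib[of norm] if_distrib[of "\<lambda>x. x ^ 2"] cong: if_cong)
    finally have "norm w * (c * norm w) \<le> norm w * 1"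
      by (simp add: power2_eq_square algebra_simps)
    then have "norm w \<le> 1 / c"
      using c(1) by (cases "norm w = 0") (auto simp: field_simps mult_le_cancel_left)
    moreover have "w $ i = matrix_inv M $ i $ k"
      by (simp add: w_def e_def matrix_vector_mult_def axis_def if_distrib[of "\<lambda>x. _ * x"] cong: if_cong)
    ultimately show ?thesis
      using Finite_Cartesian_Product.norm_nth_le[of w i] by simp
  qed
  have "norm (matrix_inv M) \<le> (\<Sum>i\<in>UNIV. \<Sum>k\<in>UNIV. norm (matrix_inv M $ i $ k))"
    by (rule norm_matrix_le_sum)
  also have "\<dots> \<le> (\<Sum>i\<in>(UNIV::'n set). \<Sum>k\<in>(UNIV::'n set). 1 / c)"
    by (intro sum_mono entry)
  finally show ?thesis by simp
qed

section \<open>Inverses of absolutely continuous matrix functions\<close>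

lemma has_vector_derivative_iff_quotient:
  fixes f :: "real \<Rightarrow> 'a::real_normed_vector"
  shows "(f has_vector_derivative d) (at x within S) \<longleftrightarrow>
    ((\<lambda>y. (1 / (y - x)) *\<^sub>R (f y - f x)) \<longlongrightarrow> d) (at x within S)"
proof -
  have "(f has_vector_derivative d) (at x within S) \<longleftrightarrow>
      ((\<lambda>y. (1 / norm (y - x)) *\<^sub>R (f y - (f x + (y - x) *\<^sub>R d))) \<longlongrightarrow> 0) (at x within S)"
    by (simp add: has_vector_derivative_def has_derivative_within bounded_linear_scaleR_left)
  also have "\<dots> \<longleftrightarrow>
      ((\<lambda>y. norm ((1 / norm (y - x)) *\<^sub>R (f y - (f x + (y - x) *\<^sub>R d)))) \<longlongrightarrow> 0) (at x within S)"
    by (rule tendsto_norm_zero_iff[symmetric])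
  also have "\<dots> \<longleftrightarrow>
      ((\<lambda>y. norm ((1 / (y - x)) *\<^sub>R (f y - f x) - d)) \<longlongrightarrow> 0) (at x within S)"
  proof (rule filterlim_cong[OF refl refl])
    have "norm ((1 / norm (y - x)) *\<^sub>R (f y - (f x + (y - x) *\<^sub>R d))) =
        norm ((1 / (y - x)) *\<^sub>R (f y - f x) - d)" if "y \<noteq> x" for y
    proof -
      have "f y - (f x + (y - x) *\<^sub>R d) = (y - x) *\<^sub>R ((1 / (y - x)) *\<^sub>R (f y - f x) - d)"
        using that by (simp add: scaleR_diff_right)
      then show ?thesis
        using that by simp
    qed
    then show "\<forall>\<^sub>F y in at x within S. norm ((1 / norm (y - x)) *\<^sub>R (f y - (f x + (y - x) *\<^sub>R d))) =
        norm ((1 / (y - x)) *\<^sub>R (f y - f x) - d)"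
      by (auto simp: eventually_at_filter)
  qed
  also have "\<dots> \<longleftrightarrow> ((\<lambda>y. (1 / (y - x)) *\<^sub>R (f y - f x)) \<longlongrightarrow> d) (at x within S)"
    by (simp add: tendsto_norm_zero_iff LIM_zero_iff)
  finally show ?thesis .
qed

lemma matrix_inv_diff:
  fixes M N :: "complex^'n^'n"
  assumes "invertible M" "invertible N"
  shows "matrix_inv M - matrix_inv N = - (matrix_inv M ** (M - N) ** matrix_inv N)"
  by (simp add: matrix_mult_diff_left matrix_mult_diff_right matrix_inv_mult[OF assms(1)]
      matrix_mul_assoc[symmetric] matrix_inv_mult[OF assms(2)])

text \<open>
  Inversion is Lipschitz on sets where the inverses are bounded, by the resolvent identity
  \<open>M\<^sup>-\<^sup>1 - N\<^sup>-\<^sup>1 = - M\<^sup>-\<^sup>1 (M - N) N\<^sup>-\<^sup>1\<close>.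
\<close>

lemma matrix_inv_lipschitz:
  obtains C where "C \<ge> 0"
    "\<And>M N :: complex^'n^'n. invertible M \<Longrightarrow> invertible N \<Longrightarrow> norm (matrix_inv M) \<le> B \<Longrightarrow>
      norm (matrix_inv N) \<le> B \<Longrightarrow> norm (matrix_inv M - matrix_inv N) \<le> C * norm (M - N)"
proof -
  obtain K where K: "K \<ge> 0" "\<And>(M :: complex^'n^'n) (N :: complex^'n^'n). norm (M ** N) \<le> norm M * norm N * K"
    using bounded_bilinear.nonneg_bounded[OF bounded_bilinear_matrix_mult] by blast
  show ?thesis
  proof
    show "B * B * (K * K) \<ge> 0" by simp
    fix M N :: "complex^'n^'n"
    assume inv: "invertible M" "invertible N" and B: "norm (matrix_inv M) \<le> B" "norm (matrix_inv N) \<le> B"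
    have "0 \<le> B" using B(1) norm_ge_zero order_trans by blast
    have "norm (matrix_inv M - matrix_inv N) = norm (matrix_inv M ** (M - N) ** matrix_inv N)"
      by (simp add: matrix_inv_diff[OF inv])
    also have "\<dots> \<le> norm (matrix_inv M ** (M - N)) * norm (matrix_inv N) * K"
      by (rule K(2))
    also have "\<dots> \<le> (norm (matrix_inv M) * norm (M - N) * K) * norm (matrix_inv N) * K"
      using K by (intro mult_right_mono) auto
    also have "\<dots> \<le> (B * norm (M - N) * K) * B * K"
      using B K(1) \<open>0 \<le> B\<close> by (intro mult_right_mono mult_mono) auto
    finally show "norm (matrix_inv M - matrix_inv N) \<le> B * B * (K * K) * norm (M - N)"
      by (simp add: mult_ac)
  qed
qed

lemma loc_abs_continuous_matrix_inv:
  fixes S :: "real \<Rightarrow> complex^'n^'n"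
  assumes ac: "loc_abs_continuous S"
    and inv: "\<And>x. x \<ge> 0 \<Longrightarrow> invertible (S x)"
    and bd: "\<And>x. x \<ge> 0 \<Longrightarrow> norm (matrix_inv (S x)) \<le> B"
  shows "loc_abs_continuous (\<lambda>x. matrix_inv (S x))"
proof -
  obtain C where C: "C \<ge> 0" "\<And>M N :: complex^'n^'n. invertible M \<Longrightarrow> invertible N \<Longrightarrow> norm (matrix_inv M) \<le> B \<Longrightarrow>
      norm (matrix_inv N) \<le> B \<Longrightarrow> norm (matrix_inv M - matrix_inv N) \<le> C * norm (M - N)"
    using matrix_inv_lipschitz[of B] by blast
  have "abs_continuous_on {0..b} (\<lambda>x. matrix_inv (S x))" if "b \<ge> 0" for b
  proof (rule abs_continuous_on_dominated[where C = C])
    show "abs_continuous_on {0..b} S" "abs_continuous_on {0..b} S"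
      using ac that by (auto simp: loc_abs_continuous_def)
    fix x y assume xy: "x \<in> {0..b}" "y \<in> {0..b}"
    have "norm (matrix_inv (S x) - matrix_inv (S y)) \<le> C * norm (S x - S y)"
      using xy by (intro C inv bd) auto
    also have "\<dots> \<le> C * (norm (S x - S y) + norm (S x - S y))"
      using C(1) by (intro mult_left_mono) auto
    finally show "norm (matrix_inv (S x) - matrix_inv (S y)) \<le> \<dots>" .
  qed
  then show ?thesis by (simp add: loc_abs_continuous_def)
qed

text \<open>
  Divide the resolvent identity by \<open>y - x\<close> and let \<open>y\<close> tend to \<open>x\<close>.
\<close>

lemma has_vector_derivative_matrix_inv:
  fixes S :: "real \<Rightarrow> complex^'n^'n"
  assumes der: "(S has_vector_derivative D) (at x within T)"
    and "x \<in> T"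
    and inv: "\<And>y. y \<in> T \<Longrightarrow> invertible (S y)"
    and bd: "\<And>y. y \<in> T \<Longrightarrow> norm (matrix_inv (S y)) \<le> B"
  shows "((\<lambda>y. matrix_inv (S y)) has_vector_derivative
    - (matrix_inv (S x) ** D ** matrix_inv (S x))) (at x within T)"
proof -
  obtain C where C: "C \<ge> 0" "\<And>M N :: complex^'n^'n. invertible M \<Longrightarrow> invertible N \<Longrightarrow> norm (matrix_inv M) \<le> B \<Longrightarrow>
      norm (matrix_inv N) \<le> B \<Longrightarrow> norm (matrix_inv M - matrix_inv N) \<le> C * norm (M - N)"
    using matrix_inv_lipschitz[of B] by blast
  have "(S \<longlongrightarrow> S x) (at x within T)"
    using has_vector_derivative_continuous[OF der] by (simp add: continuous_within)
  then have "((\<lambda>y. C * norm (S y - S x)) \<longlongrightarrow> C * 0) (at x within T)"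
    by (intro tendsto_mult_left tendsto_norm_zero) (simp add: LIM_zero)
  then have "((\<lambda>y. C * norm (S y - S x)) \<longlongrightarrow> 0) (at x within T)" by simp
  then have "((\<lambda>y. matrix_inv (S y) - matrix_inv (S x)) \<longlongrightarrow> 0) (at x within T)"
    by (rule Lim_null_comparison[rotated])
       (use \<open>x \<in> T\<close> in \<open>auto simp: eventually_at_filter intro!: always_eventually C inv bd\<close>)
  then have cont: "((\<lambda>y. matrix_inv (S y)) \<longlongrightarrow> matrix_inv (S x)) (at x within T)"
    by (rule LIM_zero_cancel)
  have "((\<lambda>y. - (matrix_inv (S y) ** ((1 / (y - x)) *\<^sub>R (S y - S x)) ** matrix_inv (S x))) \<longlongrightarrow>
      - (matrix_inv (S x) ** D ** matrix_inv (S x))) (at x within T)"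
    by (intro tendsto_minus bounded_bilinear.tendsto[OF bounded_bilinear_matrix_mult] cont tendsto_const
        has_vector_derivative_iff_quotient[THEN iffD1, OF der])
  moreover have "\<forall>\<^sub>F y in at x within T.
      - (matrix_inv (S y) ** ((1 / (y - x)) *\<^sub>R (S y - S x)) ** matrix_inv (S x)) =
      (1 / (y - x)) *\<^sub>R (matrix_inv (S y) - matrix_inv (S x))"
    using \<open>x \<in> T\<close>
    by (auto simp: eventually_at_filter matrix_inv_diff inv matrix_mult_scaleR_right matrix_mult_scaleR_left
        intro!: always_eventually)
  ultimately show ?thesis
    unfolding has_vector_derivative_iff_quotient by (rule Lim_transform_eventually)
qed

section \<open>The matrix exponential\<close>

lemma tendsto_matrix_entrywise:
  fixes f :: "'a \<Rightarrow> complex^'n^'m"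
  assumes "\<And>i k. ((\<lambda>x. f x $ i $ k) \<longlongrightarrow> l $ i $ k) F"
  shows "(f \<longlongrightarrow> l) F"
  by (intro vec_tendstoI assms)

lemma mat_power_0 [simp]: "mat_power M 0 = mat 1"
  and mat_power_Suc: "mat_power M (Suc n) = M ** mat_power M n"
  by (simp_all add: mat_power_def)

lemma mat_power_cscale: "mat_power (z *\<^sub>C M) n = z ^ n *\<^sub>C mat_power M n"
  by (induction n) (simp_all add: mat_power_Suc cscale_mult_left cscale_mult_right mult.commute)

lemma mat_power_commute:
  assumes "M ** N = N ** M"
  shows "mat_power M n ** N = N ** mat_power M n"
  by (induction n) (simp_all add: mat_power_Suc, metis assms matrix_mul_assoc)

lemma summable_mat_exp:
  fixes M :: "complex^'n^'n"
  shows "summable (\<lambda>n. (1 / fact n) *\<^sub>R mat_power M n)"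
proof -
  obtain K where K: "K \<ge> 0" "\<And>(M :: complex^'n^'n) (N :: complex^'n^'n). norm (M ** N) \<le> norm M * norm N * K"
    using bounded_bilinear.nonneg_bounded[OF bounded_bilinear_matrix_mult] by blast
  define I where "I = norm (mat 1 :: complex^'n^'n)"
  have pow: "norm (mat_power M n) \<le> (K * norm M) ^ n * I" for n
  proof (induction n)
    case 0
    then show ?case by (simp add: I_def)
  next
    case (Suc n)
    have "norm (mat_power M (Suc n)) \<le> norm M * norm (mat_power M n) * K"
      using K(2) by (simp add: mat_power_Suc)
    also have "\<dots> \<le> norm M * ((K * norm M) ^ n * I) * K"
      using Suc K(1) by (intro mult_right_mono mult_left_mono) auto
    finally show ?case by (simp add: mult_ac)
  qed
  have "summable (\<lambda>n. (inverse (fact n) * (K * norm M) ^ n) * I)"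
    by (intro summable_mult2 summable_exp)
  then show ?thesis
  proof (rule summable_comparison_test'[of _ 0])
    show "norm ((1 / fact n) *\<^sub>R mat_power M n) \<le> inverse (fact n) * (K * norm M) ^ n * I" for n
      using pow[of n] by (simp add: field_simps)
  qed
qed

lemma mat_exp_commute:
  fixes M N :: "complex^'n^'n"
  assumes "M ** N = N ** M"
  shows "mat_exp M ** N = N ** mat_exp M"
proof -
  have "mat_exp M ** N = (\<Sum>n. ((1 / fact n) *\<^sub>R mat_power M n) ** N)"
    unfolding mat_exp_def
    by (rule bounded_linear.suminf[OF bounded_bilinear.bounded_linear_left[OF bounded_bilinear_matrix_mult]])
       (rule summable_mat_exp)
  also have "\<dots> = (\<Sum>n. N ** ((1 / fact n) *\<^sub>R mat_power M n))"
    by (simp add: matrix_mult_scaleR_left matrix_mult_scaleR_right mat_power_commute[OF assms])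
  also have "\<dots> = N ** mat_exp M"
    unfolding mat_exp_def
    by (rule bounded_linear.suminf[OF bounded_bilinear.bounded_linear_right[OF bounded_bilinear_matrix_mult], symmetric])
       (rule summable_mat_exp)
  finally show ?thesis .
qed

lemma bounded_linear_entry: "bounded_linear (\<lambda>M :: complex^'n^'m. M $ i $ k)"
  by (rule bounded_linear_compose[OF bounded_linear_vec_nth bounded_linear_vec_nth])

text \<open>
  The factor \<open>N\<close> is there for two instances: \<open>N = I\<close> expands an entry of the exponential, and
  \<open>N = M\<close> expands what turns out to be its derivative.
\<close>

lemma mat_exp_entry_sums:
  fixes M N :: "complex^'n^'n"
  shows "(\<lambda>n. ((N ** mat_power M n) $ i $ k / fact n) * z ^ n) sums ((N ** mat_exp (z *\<^sub>C M)) $ i $ k)"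
proof -
  have "(\<lambda>n. (1 / fact n) *\<^sub>R mat_power (z *\<^sub>C M) n) sums mat_exp (z *\<^sub>C M)"
    unfolding mat_exp_def by (intro summable_sums summable_mat_exp)
  from bounded_linear.sums[OF bounded_linear_entry[of i k]
      bounded_linear.sums[OF bounded_bilinear.bounded_linear_right[OF bounded_bilinear_matrix_mult] this]]
  have "(\<lambda>n. (N ** ((1 / fact n) *\<^sub>R mat_power (z *\<^sub>C M) n)) $ i $ k) sums ((N ** mat_exp (z *\<^sub>C M)) $ i $ k)" .
  moreover have "(N ** ((1 / fact n) *\<^sub>R mat_power (z *\<^sub>C M) n)) $ i $ k =
      ((N ** mat_power M n) $ i $ k / fact n) * z ^ n" for n
    by (simp add: matrix_mult_scaleR_right mat_power_cscale cscale_mult_right cscale_nth)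
       (simp add: scaleR_conv_of_real field_simps)
  ultimately show ?thesis by simp
qed

text \<open>
  Each entry is an everywhere convergent power series in the scalar \<open>z\<close>; differentiating it
  termwise shifts \<open>M\<^sup>n / n!\<close> to \<open>M\<^sup>n\<^sup>+\<^sup>1 / n!\<close>.
\<close>

lemma mat_exp_entry_has_field_derivative:
  fixes M :: "complex^'n^'n"
  shows "((\<lambda>z. mat_exp (z *\<^sub>C M) $ i $ k) has_field_derivative (M ** mat_exp (z *\<^sub>C M)) $ i $ k) (at z)"
proof -
  define c where "c n = mat_power M n $ i $ k / fact n" for n
  have sums: "(\<lambda>n. c n * z ^ n) sums (mat_exp (z *\<^sub>C M) $ i $ k)" for z
    using mat_exp_entry_sums[of "mat 1" M i k z] by (simp add: c_def)
  have "diffs c n = (M ** mat_power M n) $ i $ k / fact n" for n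
  proof -
    have "of_nat (Suc n) * (x / fact (Suc n)) = x / fact n" for x :: complex
      by (simp add: divide_simps del: of_nat_Suc)
    then show ?thesis by (simp only: diffs_def c_def mat_power_Suc)
  qed
  then have "(\<lambda>n. diffs c n * z ^ n) sums ((M ** mat_exp (z *\<^sub>C M)) $ i $ k)"
    using mat_exp_entry_sums[of M M i k z] by simp
  moreover have "((\<lambda>z. \<Sum>n. c n * z ^ n) has_field_derivative (\<Sum>n. diffs c n * z ^ n)) (at z)"
    by (rule termdiffs_strong_converges_everywhere) (rule sums_summable[OF sums])
  ultimately show ?thesis
    by (simp add: sums_unique[OF sums, symmetric] sums_unique[symmetric])
qed

lemma mat_exp_has_vector_derivative:
  fixes M :: "complex^'n^'n"
  shows "((\<lambda>t. mat_exp ((c * of_real t) *\<^sub>C M)) has_vector_derivative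
    c *\<^sub>C (M ** mat_exp ((c * of_real t) *\<^sub>C M))) (at t)"
proof -
  have entry: "((\<lambda>t. mat_exp ((c * of_real t) *\<^sub>C M) $ i $ k) has_vector_derivative
      (c *\<^sub>C (M ** mat_exp ((c * of_real t) *\<^sub>C M))) $ i $ k) (at t)" for i k
  proof -
    have "((\<lambda>t. c * of_real t) has_vector_derivative c * of_real 1) (at t)"
      by (intro derivative_intros)
    from field_vector_diff_chain_at[OF this mat_exp_entry_has_field_derivative]
    show ?thesis by (simp add: o_def cscale_def)
  qed
  show ?thesis
    unfolding has_vector_derivative_iff_quotient
  proof (rule tendsto_matrix_entrywise)
    fix i k
    show "((\<lambda>y. ((1 / (y - t)) *\<^sub>R (mat_exp ((c * of_real y) *\<^sub>C M) - mat_exp ((c * of_real t) *\<^sub>C M))) $ i $ k)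
      \<longlongrightarrow> (c *\<^sub>C (M ** mat_exp ((c * of_real t) *\<^sub>C M))) $ i $ k) (at t)"
      using entry[of i k] unfolding has_vector_derivative_iff_quotient by simp
  qed
qed

section \<open>The algebra of the transformed canonical system\<close>

text \<open>
  This is where the identity \<open>A S - S A\<^sup>* = \<i> \<Lambda> j \<Lambda>\<^sup>*\<close> enters. The left-hand matrix is
  \<open>w = w\<^sub>A(x,0)\<close>. By the identity, \<open>A\<^sup>-\<^sup>1 (\<i> \<Lambda> j \<Lambda>\<^sup>*) = S - A\<^sup>-\<^sup>1 S A\<^sup>*\<close>, whence
  \<open>w j \<Lambda>\<^sup>* = j \<Lambda>\<^sup>* S\<^sup>-\<^sup>1 A\<^sup>-\<^sup>1 S A\<^sup>*\<close>, and the factor \<open>S A\<^sup>*\<close> cancels.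
\<close>

lemma transfer_fun_intertwining:
  fixes A s :: "complex^'n^'n" and L :: "complex^('p::finite + 'p)^'n"
  assumes A: "invertible A" and s: "invertible s"
    and id: "A ** s - s ** adj A = \<i> *\<^sub>C (L ** jmat ** adj L)"
  shows "(mat 1 - \<i> *\<^sub>C (jmat ** adj L ** matrix_inv s ** matrix_inv A ** L))
      ** (jmat ** adj L ** matrix_inv (adj A) ** matrix_inv s) =
    jmat ** adj L ** matrix_inv s ** matrix_inv A"
proof -
  define P where "P = jmat ** adj L"
  define si where "si = matrix_inv s"
  define Ai where "Ai = matrix_inv A"
  define B where "B = matrix_inv (adj A)"
  note inv = matrix_inv_mult[OF A, folded Ai_def] matrix_inv_mult[OF s, folded si_def]
    matrix_inv_mult[OF invertible_adj[OF A], folded B_def]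
  have LP: "\<i> *\<^sub>C (L ** P) = A ** s - s ** adj A"
    using id by (simp add: P_def matrix_mul_assoc)
  have "(mat 1 - \<i> *\<^sub>C (P ** si ** Ai ** L)) ** P = P - P ** si ** Ai ** (\<i> *\<^sub>C (L ** P))"
    by (simp add: matrix_mult_diff_left cscale_mult_left cscale_mult_right matrix_mul_assoc)
  also have "\<dots> = P - (P ** (si ** ((Ai ** A) ** s)) - P ** si ** Ai ** s ** adj A)"
    unfolding LP by (simp add: matrix_mult_diff_right matrix_mul_assoc)
  also have "\<dots> = P ** si ** Ai ** s ** adj A"
    by (simp add: inv)
  finally have wP: "(mat 1 - \<i> *\<^sub>C (P ** si ** Ai ** L)) ** P = P ** si ** Ai ** s ** adj A" .
  have "(mat 1 - \<i> *\<^sub>C (P ** si ** Ai ** L)) ** (P ** B ** si) =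
      ((mat 1 - \<i> *\<^sub>C (P ** si ** Ai ** L)) ** P) ** B ** si"
    by (simp add: matrix_mul_assoc)
  also have "\<dots> = P ** si ** Ai ** s ** (adj A ** B) ** si"
    unfolding wP by (simp add: matrix_mul_assoc)
  also have "\<dots> = P ** si ** Ai ** (s ** si)"
    by (simp only: inv matrix_mul_rid matrix_mul_assoc[symmetric])
  also have "\<dots> = P ** si ** Ai"
    by (simp add: inv)
  finally show ?thesis
    by (simp only: P_def si_def Ai_def B_def)
qed

text \<open>
  The canonical system at one point \<open>x\<close>, as pure matrix algebra: \<open>L\<close>, \<open>s\<close>, \<open>h\<close>, \<open>E\<close> are the values
  of \<open>\<Lambda>\<close>, \<open>S\<close>, \<open>H\<close> and of the exponential. On the left is \<open>w\<^sup>* H w Y\<^sub>t\<close>; on the right is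
  \<open>j Y\<^sub>x\<close>, with \<open>Y\<^sub>x\<close> in the form that the product rule gives. Since \<open>j\<^sup>2 = I\<close>, both sides are
  \<open>\<i> w\<^sup>* H j \<Lambda>\<^sup>* S\<^sup>-\<^sup>1 E A\<^sup>-\<^sup>1\<close>: on the left by the intertwining property of \<open>w\<close>, on the right
  because the derivatives of \<open>\<Lambda>\<^sup>*\<close> and \<open>S\<^sup>-\<^sup>1\<close> supply the two terms of \<open>w\<^sup>*\<close>.
\<close>

lemma canonical_system_identity:
  fixes A s E :: "complex^'n^'n" and L :: "complex^('p::finite + 'p)^'n"
    and h :: "complex^('p + 'p)^('p + 'p)"
  assumes A: "invertible A" and s: "invertible s"
    and id: "A ** s - s ** adj A = \<i> *\<^sub>C (L ** jmat ** adj L)"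
    and herm: "adj s = s" "adj h = h"
    and E: "matrix_inv A ** E = E ** matrix_inv A"
  defines "w \<equiv> mat 1 - \<i> *\<^sub>C (jmat ** adj L ** matrix_inv s ** matrix_inv A ** L)"
  shows "adj w ** h ** w ** (\<i> *\<^sub>C (jmat ** adj L ** matrix_inv (adj A) ** matrix_inv s ** E)) =
    jmat ** ((jmat ** adj L ** matrix_inv (adj A) **
          - (matrix_inv s ** (L ** jmat ** h ** jmat ** adj L) ** matrix_inv s) +
        jmat ** adj ((- \<i>) *\<^sub>C (A ** L ** jmat ** h)) ** matrix_inv (adj A) ** matrix_inv s)
      ** E ** matrix_inv A)"
proof -
  define si where "si = matrix_inv s"
  define Ai where "Ai = matrix_inv A"
  define B where "B = matrix_inv (adj A)"
  define G where "G = h ** jmat ** adj L ** si"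
  have adj_si: "adj si = si"
    using adj_matrix_inv[OF s] by (simp add: si_def herm)
  have adj_Ai: "adj Ai = B"
    using adj_matrix_inv[OF A] by (simp add: Ai_def B_def)
  have jj: "X ** jmat ** jmat = X" for X :: "complex^('p + 'p)^'m"
    by (simp add: matrix_mul_assoc[symmetric])
  have adjw: "adj w = mat 1 + \<i> *\<^sub>C (adj L ** B ** si ** L ** jmat)"
    by (simp add: w_def si_def[symmetric] Ai_def[symmetric] adj_diff adj_cscale adj_mult adj_Ai adj_si
        matrix_mul_assoc cscale_minus)
  have "adj w ** h ** w ** (\<i> *\<^sub>C (jmat ** adj L ** B ** si ** E)) =
      \<i> *\<^sub>C (adj w ** h ** (w ** (jmat ** adj L ** B ** si)) ** E)"
    by (simp add: cscale_mult_right matrix_mul_assoc)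
  also have "w ** (jmat ** adj L ** B ** si) = jmat ** adj L ** si ** Ai"
    unfolding w_def si_def Ai_def B_def by (rule transfer_fun_intertwining[OF A s id])
  also have "adj w ** h ** (jmat ** adj L ** si ** Ai) ** E = adj w ** G ** (Ai ** E)"
    by (simp add: G_def matrix_mul_assoc)
  also have "\<i> *\<^sub>C \<dots> = \<i> *\<^sub>C (adj w ** G) ** E ** Ai"
    unfolding E[folded Ai_def] by (simp add: matrix_mul_assoc cscale_mult_left)
  also have "\<i> *\<^sub>C (adj w ** G) = \<i> *\<^sub>C G - adj L ** B ** si ** L ** jmat ** G"
    by (simp add: adjw matrix_mult_add_left cscale_mult_left cscale_add cscale_minus)
  also have "\<dots> = jmat ** (jmat ** adj L ** B ** - (si ** (L ** jmat ** h ** jmat ** adj L) ** si) +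
        jmat ** adj ((- \<i>) *\<^sub>C (A ** L ** jmat ** h)) ** B ** si)"
  proof -
    have "jmat ** (jmat ** adj L ** B ** - (si ** (L ** jmat ** h ** jmat ** adj L) ** si)) =
        - (adj L ** B ** si ** L ** jmat ** G)"
      by (simp add: matrix_mult_minus_right matrix_mul_assoc G_def)
    moreover have "jmat ** (jmat ** adj ((- \<i>) *\<^sub>C (A ** L ** jmat ** h)) ** B ** si) =
        \<i> *\<^sub>C (h ** jmat ** adj L ** (adj A ** B) ** si)"
      by (simp add: adj_cscale adj_mult herm cscale_mult_right cscale_mult_left matrix_mul_assoc)
    moreover have "adj A ** B = mat 1"
      unfolding B_def by (rule matrix_inv_mult[OF invertible_adj[OF A]])
    ultimately show ?thesis
      by (simp add: matrix_mult_add_right G_def)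
  qed
  finally show ?thesis
    by (simp add: si_def Ai_def B_def matrix_mul_assoc)
qed

section \<open>Identities and inequalities propagated by the differential equations\<close>

lemma hamiltonian_adj: "hamiltonian H \<Longrightarrow> x \<ge> 0 \<Longrightarrow> adj (H x) = H x"
  by (simp add: hamiltonian_def pos_semidef_def hermitian_def)

lemma hamiltonian_inner_nonneg: "hamiltonian H \<Longrightarrow> x \<ge> 0 \<Longrightarrow> 0 \<le> v \<bullet> (H x *v v)"
  by (simp add: hamiltonian_def pos_semidef_def Re_quad_form)

lemma ac_solution_hermitian:
  fixes S :: "real \<Rightarrow> complex^'n^'n"
  assumes sol: "ac_solution S G"
    and G: "\<And>x. x \<ge> 0 \<Longrightarrow> adj (G x) = G x"
    and "adj (S 0) = S 0" "x \<ge> 0"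
  shows "adj (S x) = S x"
proof -
  have ac: "loc_abs_continuous S"
    and der: "AE x in lebesgue. x \<ge> 0 \<longrightarrow> (S has_vector_derivative G x) (at x within {0..})"
    using sol by (simp_all add: ac_solution_def)
  have "adj (S x) - S x = adj (S 0) - S 0"
  proof (rule loc_abs_continuous_eq_initial[OF _ _ \<open>x \<ge> 0\<close>])
    show "loc_abs_continuous (\<lambda>x. adj (S x) - S x)"
      by (intro loc_abs_continuous_diff bounded_linear.loc_abs_continuous[OF bounded_linear_adj] ac)
    show "AE x in lebesgue. x \<ge> 0 \<longrightarrow> ((\<lambda>x. adj (S x) - S x) has_vector_derivative 0) (at x within {0..})"
      using der
    proof eventually_elim
      case (elim x)
      show ?case
      proof
        assume x: "x \<ge> 0"
        then have "(S has_vector_derivative G x) (at x within {0..})" using elim by simp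
        then have "((\<lambda>x. adj (S x) - S x) has_vector_derivative adj (G x) - G x) (at x within {0..})"
          by (intro has_vector_derivative_diff bounded_linear.has_vector_derivative[OF bounded_linear_adj])
        then show "((\<lambda>x. adj (S x) - S x) has_vector_derivative 0) (at x within {0..})"
          using G[OF x] by simp
      qed
    qed
  qed
  then show ?thesis unfolding assms(3) by (simp only: diff_self right_minus_eq)
qed

text \<open>
  A positive semidefinite right-hand side makes \<open>S\<close> increase in the Loewner order, so
  that \<open>S(x)\<close> inherits the coercivity constant of \<open>S(0)\<close>.
\<close>

lemma ac_solution_quadratic_form_mono:
  fixes S :: "real \<Rightarrow> complex^'n^'n"
  assumes sol: "ac_solution S G"
    and G: "\<And>x. x \<ge> 0 \<Longrightarrow> 0 \<le> v \<bullet> (G x *v v)"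
    and "x \<ge> 0"
  shows "v \<bullet> (S 0 *v v) \<le> v \<bullet> (S x *v v)"
proof (rule loc_abs_continuous_nondecreasing[OF _ _ \<open>x \<ge> 0\<close>])
  have ac: "loc_abs_continuous S"
    and der: "AE x in lebesgue. x \<ge> 0 \<longrightarrow> (S has_vector_derivative G x) (at x within {0..})"
    using sol by (simp_all add: ac_solution_def)
  have lin: "bounded_linear (\<lambda>M :: complex^'n^'n. v \<bullet> (M *v v))"
    by (rule bounded_linear_compose[OF bounded_linear_inner_right bounded_linear_matrix_vector_left])
  show "loc_abs_continuous (\<lambda>x. v \<bullet> (S x *v v))"
    by (rule bounded_linear.loc_abs_continuous[OF lin ac])
  show "AE x in lebesgue. x \<ge> 0 \<longrightarrow>
      (\<exists>d\<ge>0. ((\<lambda>x. v \<bullet> (S x *v v)) has_vector_derivative d) (at x within {0..}))"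
    using der
  proof eventually_elim
    case (elim x)
    show ?case
    proof
      assume x: "x \<ge> 0"
      with elim have "(S has_vector_derivative G x) (at x within {0..})" by blast
      from bounded_linear.has_vector_derivative[OF lin this] G[OF x]
      show "\<exists>d\<ge>0. ((\<lambda>x. v \<bullet> (S x *v v)) has_vector_derivative d) (at x within {0..})"
        by (intro exI conjI)
    qed
  qed
qed

text \<open>
  Both sides of the identity have the derivative
  \<open>A \<Lambda> j H j \<Lambda>\<^sup>* - \<Lambda> j H j \<Lambda>\<^sup>* A\<^sup>*\<close>; the one on the right uses that \<open>H\<close> is Hermitian.
\<close>

lemma lyapunov_identity_preserved:
  fixes H :: "real \<Rightarrow> complex^('p::finite + 'p)^('p + 'p)"
    and A :: "complex^'n^'n"
  assumes H: "\<And>x. x \<ge> 0 \<Longrightarrow> adj (H x) = H x"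
    and id: "A ** S 0 - S 0 ** adj A = \<i> *\<^sub>C (\<Lambda> 0 ** jmat ** adj (\<Lambda> 0))"
    and solL: "ac_solution \<Lambda> (\<lambda>x. (- \<i>) *\<^sub>C (A ** \<Lambda> x ** jmat ** H x))"
    and solS: "ac_solution S (\<lambda>x. \<Lambda> x ** jmat ** H x ** jmat ** adj (\<Lambda> x))"
    and "x \<ge> 0"
  shows "A ** S x - S x ** adj A = \<i> *\<^sub>C (\<Lambda> x ** jmat ** adj (\<Lambda> x))"
proof -
  note left = bounded_bilinear.bounded_linear_left[OF bounded_bilinear_matrix_mult]
    and right = bounded_bilinear.bounded_linear_right[OF bounded_bilinear_matrix_mult]
  let ?F = "\<lambda>x. A ** S x - S x ** adj A - \<i> *\<^sub>C (\<Lambda> x ** jmat ** adj (\<Lambda> x))"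
  have "?F x = ?F 0"
  proof (rule loc_abs_continuous_eq_initial[OF _ _ \<open>x \<ge> 0\<close>])
    have ac: "loc_abs_continuous \<Lambda>" "loc_abs_continuous S"
      using solL solS by (simp_all add: ac_solution_def)
    show "loc_abs_continuous ?F"
      by (intro loc_abs_continuous_diff loc_abs_continuous_bilinear[OF bounded_bilinear_matrix_mult]
          bounded_linear.loc_abs_continuous[OF bounded_linear_adj]
          bounded_linear.loc_abs_continuous[OF bounded_linear_cscale]
          bounded_linear.loc_abs_continuous[OF left] bounded_linear.loc_abs_continuous[OF right] ac)
    have "AE x in lebesgue. x \<ge> 0 \<longrightarrow>
        (\<Lambda> has_vector_derivative (- \<i>) *\<^sub>C (A ** \<Lambda> x ** jmat ** H x)) (at x within {0..})"
      "AE x in lebesgue. x \<ge> 0 \<longrightarrow>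
        (S has_vector_derivative \<Lambda> x ** jmat ** H x ** jmat ** adj (\<Lambda> x)) (at x within {0..})"
      using solL solS by (simp_all add: ac_solution_def)
    then show "AE x in lebesgue. x \<ge> 0 \<longrightarrow> (?F has_vector_derivative 0) (at x within {0..})"
    proof eventually_elim
      case (elim x)
      show ?case
      proof
        assume x: "x \<ge> 0"
        let ?L = "(- \<i>) *\<^sub>C (A ** \<Lambda> x ** jmat ** H x)"
        let ?S = "\<Lambda> x ** jmat ** H x ** jmat ** adj (\<Lambda> x)"
        have "(?F has_vector_derivative (A ** ?S - ?S ** adj A -
            \<i> *\<^sub>C ((\<Lambda> x ** jmat) ** adj ?L + (?L ** jmat) ** adj (\<Lambda> x)))) (at x within {0..})"
          using elim x
          by (intro has_vector_derivative_diff bounded_linear.has_vector_derivative[OF bounded_linear_cscale]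
              bounded_bilinear.has_vector_derivative[OF bounded_bilinear_matrix_mult]
              bounded_linear.has_vector_derivative[OF bounded_linear_adj]
              bounded_linear.has_vector_derivative[OF left] bounded_linear.has_vector_derivative[OF right]) auto
        moreover have "A ** ?S - ?S ** adj A -
            \<i> *\<^sub>C ((\<Lambda> x ** jmat) ** adj ?L + (?L ** jmat) ** adj (\<Lambda> x)) = 0"
          by (simp add: adj_cscale adj_mult H[OF x] cscale_mult_left cscale_mult_right cscale_add matrix_mul_assoc)
             (simp add: cscale_minus)
        ultimately show "(?F has_vector_derivative 0) (at x within {0..})" by simp
      qed
    qed
  qed
  then show ?thesis using id by simp
qed

section \<open>The transformed dynamical canonical system\<close>

theorem proposition7p3:
  fixes H :: "real \<Rightarrow> complex^('p::finite + 'p)^('p + 'p)"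
    and A :: "complex^'n^'n"
    and \<Lambda> :: "real \<Rightarrow> complex^('p + 'p)^'n"
    and S :: "real \<Rightarrow> complex^'n^'n"
  assumes "hamiltonian H"
    and "det A \<noteq> 0"
    and "pos_def (S 0)"
    and "A ** S 0 - S 0 ** adj A = \<i> *\<^sub>C (\<Lambda> 0 ** jmat ** adj (\<Lambda> 0))"
    and "ac_solution \<Lambda> (\<lambda>x. (- \<i>) *\<^sub>C (A ** \<Lambda> x ** jmat ** H x))"
    and "ac_solution S (\<lambda>x. \<Lambda> x ** jmat ** H x ** jmat ** adj (\<Lambda> x))"
  shows "dynamical_canonical_solution
    (\<lambda>x. adj (transfer_fun A \<Lambda> S x 0) ** H x ** transfer_fun A \<Lambda> S x 0)
    (\<lambda>x t. jmat ** adj (\<Lambda> x) ** matrix_inv (adj A) ** matrix_inv (S x)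
             ** mat_exp ((\<i> * of_real t) *\<^sub>C A) ** matrix_inv A)"
proof -
  note left = bounded_bilinear.bounded_linear_left[OF bounded_bilinear_matrix_mult]
    and right = bounded_bilinear.bounded_linear_right[OF bounded_bilinear_matrix_mult]
  have A: "invertible A"
    using assms(2) by (simp add: invertible_det_nz)
  have H: "adj (H x) = H x" if "x \<ge> 0" for x
    using hamiltonian_adj assms(1) that .
  have id: "A ** S x - S x ** adj A = \<i> *\<^sub>C (\<Lambda> x ** jmat ** adj (\<Lambda> x))" if "x \<ge> 0" for x
    using lyapunov_identity_preserved[OF H assms(4-6) that] .
  have herm: "adj (S x) = S x" if "x \<ge> 0" for x
    by (rule ac_solution_hermitian[OF assms(6) _ _ that])
       (use assms(3) in \<open>simp_all add: adj_mult H matrix_mul_assoc pos_def_def hermitian_def\<close>)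
  obtain c where c: "c > 0" "\<And>v. c * (norm v)\<^sup>2 \<le> v \<bullet> (S 0 *v v)"
    using pos_def_coercive[OF assms(3)] by blast
  have coercive: "c * (norm v)\<^sup>2 \<le> v \<bullet> (S x *v v)" if "x \<ge> 0" for x v
  proof -
    have "0 \<le> v \<bullet> ((\<Lambda> y ** jmat ** H y ** jmat ** adj (\<Lambda> y)) *v v)" if "y \<ge> 0" for y
    proof -
      define u where "u = (jmat ** adj (\<Lambda> y)) *v v"
      have "v \<bullet> ((\<Lambda> y ** jmat ** H y ** jmat ** adj (\<Lambda> y)) *v v) =
          v \<bullet> ((\<Lambda> y ** jmat) *v (H y *v u))"
        by (simp add: u_def matrix_vector_mul_assoc matrix_mul_assoc)
      also have "\<dots> = u \<bullet> (H y *v u)"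
        unfolding inner_matrix_vector_adj[of v "\<Lambda> y ** jmat"] by (simp add: u_def adj_mult)
      finally show ?thesis
        using hamiltonian_inner_nonneg[OF assms(1) that] by simp
    qed
    then have "v \<bullet> (S 0 *v v) \<le> v \<bullet> (S x *v v)"
      by (rule ac_solution_quadratic_form_mono[OF assms(6) _ \<open>x \<ge> 0\<close>])
    then show ?thesis using c(2)[of v] by linarith
  qed
  have inv: "invertible (S x)" if "x \<ge> 0" for x
    using coercive_invertible[OF c(1) coercive[OF that]] .
  have bd: "norm (matrix_inv (S x)) \<le> real CARD('n) * real CARD('n) / c" if "x \<ge> 0" for x
    using coercive_norm_matrix_inv[OF c(1) coercive[OF that]] .
  have ac: "loc_abs_continuous \<Lambda>" "loc_abs_continuous S"
    using assms(5,6) by (simp_all add: ac_solution_def)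
  show ?thesis
    unfolding dynamical_canonical_solution_def
  proof (intro conjI allI)
    fix t
    show "loc_abs_continuous (\<lambda>x. jmat ** adj (\<Lambda> x) ** matrix_inv (adj A) ** matrix_inv (S x)
             ** mat_exp ((\<i> * of_real t) *\<^sub>C A) ** matrix_inv A)"
      by (intro bounded_linear.loc_abs_continuous[OF left]
          loc_abs_continuous_bilinear[OF bounded_bilinear_matrix_mult]
          loc_abs_continuous_matrix_inv[OF ac(2) inv bd]
          bounded_linear.loc_abs_continuous[OF right]
          bounded_linear.loc_abs_continuous[OF bounded_linear_adj] ac(1))
  next
    have "AE x in lebesgue. x \<ge> 0 \<longrightarrow>
        (\<Lambda> has_vector_derivative (- \<i>) *\<^sub>C (A ** \<Lambda> x ** jmat ** H x)) (at x within {0..})"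
      "AE x in lebesgue. x \<ge> 0 \<longrightarrow>
        (S has_vector_derivative \<Lambda> x ** jmat ** H x ** jmat ** adj (\<Lambda> x)) (at x within {0..})"
      using assms(5,6) by (simp_all add: ac_solution_def)
    then show "AE x in lebesgue. x \<ge> 0 \<longrightarrow> (\<forall>t. \<exists>Yt Yx.
        ((\<lambda>s. jmat ** adj (\<Lambda> x) ** matrix_inv (adj A) ** matrix_inv (S x)
             ** mat_exp ((\<i> * of_real s) *\<^sub>C A) ** matrix_inv A) has_vector_derivative Yt) (at t) \<and>
        ((\<lambda>y. jmat ** adj (\<Lambda> y) ** matrix_inv (adj A) ** matrix_inv (S y)
             ** mat_exp ((\<i> * of_real t) *\<^sub>C A) ** matrix_inv A) has_vector_derivative Yx)
          (at x within {0..}) \<and>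
        adj (transfer_fun A \<Lambda> S x 0) ** H x ** transfer_fun A \<Lambda> S x 0 ** Yt = jmat ** Yx)"
    proof eventually_elim
      case (elim x)
      show ?case
      proof (intro impI allI)
        fix t :: real
        assume x: "x \<ge> 0"
        let ?E = "\<lambda>s. mat_exp ((\<i> * of_real s) *\<^sub>C A)"
        let ?Q = "jmat ** adj (\<Lambda> x) ** matrix_inv (adj A) ** matrix_inv (S x)"
        let ?Yt = "\<i> *\<^sub>C (?Q ** ?E t)"
        let ?Yx = "(jmat ** adj (\<Lambda> x) ** matrix_inv (adj A) **
              - (matrix_inv (S x) ** (\<Lambda> x ** jmat ** H x ** jmat ** adj (\<Lambda> x)) ** matrix_inv (S x)) +
            jmat ** adj ((- \<i>) *\<^sub>C (A ** \<Lambda> x ** jmat ** H x)) ** matrix_inv (adj A) ** matrix_inv (S x))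
          ** ?E t ** matrix_inv A"
        \<comment> \<open>The exponential is a power series in \<open>A\<close>, so it commutes with \<open>A\<close> and \<open>A\<^sup>-\<^sup>1\<close>.\<close>
        have EA: "?E t ** A = A ** ?E t"
          by (rule mat_exp_commute) (simp add: cscale_mult_left cscale_mult_right)
        have EAi: "matrix_inv A ** ?E t = ?E t ** matrix_inv A"
          by (rule mat_exp_commute[symmetric])
             (simp add: cscale_mult_left cscale_mult_right matrix_inv_mult[OF A])
        have "((\<lambda>s. ?Q ** ?E s ** matrix_inv A) has_vector_derivative
            ?Q ** (\<i> *\<^sub>C (A ** ?E t)) ** matrix_inv A) (at t)"
          by (intro bounded_linear.has_vector_derivative[OF left]
              bounded_linear.has_vector_derivative[OF right] mat_exp_has_vector_derivative)
        also have "?Q ** (\<i> *\<^sub>C (A ** ?E t)) ** matrix_inv A = \<i> *\<^sub>C (?Q ** ?E t ** (A ** matrix_inv A))"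
          unfolding EA[symmetric] by (simp add: cscale_mult_left cscale_mult_right matrix_mul_assoc)
        also have "\<dots> = ?Yt"
          by (simp add: matrix_inv_mult[OF A])
        finally have Yt: "((\<lambda>s. ?Q ** ?E s ** matrix_inv A) has_vector_derivative ?Yt) (at t)" .
        have Yx: "((\<lambda>y. jmat ** adj (\<Lambda> y) ** matrix_inv (adj A) ** matrix_inv (S y) ** ?E t ** matrix_inv A)
            has_vector_derivative ?Yx) (at x within {0..})"
          using elim x inv bd
          by (intro bounded_linear.has_vector_derivative[OF left]
              bounded_bilinear.has_vector_derivative[OF bounded_bilinear_matrix_mult]
              has_vector_derivative_matrix_inv
              bounded_linear.has_vector_derivative[OF right]
              bounded_linear.has_vector_derivative[OF bounded_linear_adj]) auto
        have w: "transfer_fun A \<Lambda> S x 0 =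
            mat 1 - \<i> *\<^sub>C (jmat ** adj (\<Lambda> x) ** matrix_inv (S x) ** matrix_inv A ** \<Lambda> x)"
          by (simp add: transfer_fun_def)
        have "adj (transfer_fun A \<Lambda> S x 0) ** H x ** transfer_fun A \<Lambda> S x 0 ** ?Yt = jmat ** ?Yx"
          unfolding w
          by (rule canonical_system_identity[OF A inv[OF x] id[OF x] herm[OF x] H[OF x] EAi])
        with Yt Yx show "\<exists>Yt Yx.
          ((\<lambda>s. ?Q ** ?E s ** matrix_inv A) has_vector_derivative Yt) (at t) \<and>
          ((\<lambda>y. jmat ** adj (\<Lambda> y) ** matrix_inv (adj A) ** matrix_inv (S y) ** ?E t ** matrix_inv A)
            has_vector_derivative Yx) (at x within {0..}) \<and>
          adj (transfer_fun A \<Lambda> S x 0) ** H x ** transfer_fun A \<Lambda> S x 0 ** Yt = jmat ** Yx"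
          by blast
      qed
    qed
  qed
qed

end
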